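(* Let $X$ be a Hilbert space. Then for every $p\in[1,\infty]$, every complete probability space $(\Omega,\mathcal{A},(\mathcal{F}_n)_{n\ge1},\mathbb{P})$ and every $(\mathcal{F}_n)_{n\ge1}$-adapted $X$-valued sequence $f=(f_n)_{n\ge1}$ in $L^p(\Omega;X)$ one has $$\|f_n\|_p\le D_{\mathbb{R}}\|g_n\|_p\qquad\text{for all } n\in\mathbb{N},$$ where $g$ is an $\mathcal{F}_\infty$-decoupled sum sequence of $f$ and $D_{\mathbb{R}}:=\sup_{p\in[1,\infty]}D_p(\mathbb{R})<\infty$.
   Context: Let $(\Omega,\mathcal{A},(\mathcal{F}_n)_{n\ge1},\mathbb{P})$ be a complete probability space with a filtration, $\mathcal{F}_0=\{\Omega,\varnothing\}$, $\mathcal{F}_\infty=\sigma(\mathcal{F}_n:n\ge1)$. For an $(\mathcal{F}_n)$-adapted sequence $(d_n)_{n\ge1}$ of $X$-valued random variables (Borel measurable with separable range), an $\mathcal{F}_\infty$-decoupled tangent sequence is a sequence $(e_n)_{n\ge1}$ of $X$-valued random variables on $(\Omega,\mathcal{A},\mathbb{P})$ with (a) $\mathbb{P}(d_n\in B\,|\,\mathcal{F}_{n-1})=\mathbb{P}(e_n\in B\,|\,\mathcal{F}_\infty)$ for all $n\ge1$, Borel $B\subseteq X$, and (b) $\mathbb{P}(e_1\in B_1,\dots,e_n\in B_n\,|\,\mathcal{F}_\infty)=\prod_{k=1}^n\mathbb{P}(e_k\in B_k\,|\,\mathcal{F}_\infty)$ for all $n$ and Borel $B_k$. A sequence $g$ is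 an $\mathcal{F}_\infty$-decoupled sum sequence of an adapted sequence $f$ if $(g_n-g_{n-1})_{n\ge1}$ is an $\mathcal{F}_\infty$-decoupled tangent sequence of $(f_n-f_{n-1})_{n\ge1}$, where $f_0=g_0\equiv0$. $D_p(X)$ denotes the least constant $D_p$ such that $\|f_n\|_p\le D_p\|g_n\|_p$ for all $n\ge1$, for all complete filtered probability spaces, all $X$-valued adapted $f=(f_n)\subseteq L^p(\Omega;X)$ and $g$ an $\mathcal{F}_\infty$-decoupled sum sequence of $f$. The finiteness of $D_{\mathbb{R}}=\sup_{p\in[1,\infty]}D_p(\mathbb{R})$ is a known theorem of Hitczenko and may be assumed. *)

theory Defs
  imports "HOL-Probability.Probability"
begin

text \<open>
  The filtration is indexed by all natural numbers, with index 0 carrying the trivial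
  \<open>\<sigma>\<close>-algebra. Only the ambient space is complete; the \<open>F n\<close> need not contain the null sets.
\<close>

locale complete_filtered_prob_space =
  prob_space M + complete_measure M + filtration "space M" F
  for M :: "'a measure" and F :: "nat \<Rightarrow> 'a measure" +
  assumes subalgebra_F: "\<And>n. subalgebra M (F n)"
    and sets_F_0: "sets (F 0) = {{}, space M}"

definition filtration_limit :: "'a measure \<Rightarrow> (nat \<Rightarrow> 'a measure) \<Rightarrow> 'a measure" where
  "filtration_limit M F = sigma (space M) (\<Union>n\<in>{1..}. sets (F n))"

definition strongly_measurable :: "'a measure \<Rightarrow> ('a \<Rightarrow> 'x::real_normed_vector) \<Rightarrow> bool" where
  "strongly_measurable M f \<longleftrightarrow>
     f \<in> borel_measurable M \<and> separable_space (top_of_set (f ` space M))"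

text \<open>Sequences of random variables start at index 1; their value at index 0 is never used.\<close>

definition adapted_seq :: "(nat \<Rightarrow> 'a measure) \<Rightarrow> (nat \<Rightarrow> 'a \<Rightarrow> 'x::real_normed_vector) \<Rightarrow> bool" where
  "adapted_seq F f \<longleftrightarrow> (\<forall>n\<ge>1. strongly_measurable (F n) (f n))"

text \<open>The convention \<open>f\<^sub>0 = 0\<close> is built in here.\<close>

definition increments :: "(nat \<Rightarrow> 'a \<Rightarrow> 'x::real_normed_vector) \<Rightarrow> nat \<Rightarrow> 'a \<Rightarrow> 'x" where
  "increments f n = (\<lambda>\<omega>. if n \<le> 1 then f n \<omega> else f n \<omega> - f (n - 1) \<omega>)"

text \<open>\<open>P(A | G)\<close> as a conditional expectation, determined up to almost sure equality.\<close>

definition cond_probability :: "'a measure \<Rightarrow> 'a measure \<Rightarrow> 'a set \<Rightarrow> 'a \<Rightarrow> real" where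
  "cond_probability M G A = real_cond_exp M G (indicator A)"

definition decoupled_tangent ::
  "'a measure \<Rightarrow> (nat \<Rightarrow> 'a measure) \<Rightarrow> (nat \<Rightarrow> 'a \<Rightarrow> 'x::real_normed_vector) \<Rightarrow> (nat \<Rightarrow> 'a \<Rightarrow> 'x) \<Rightarrow> bool"
where
  "decoupled_tangent M F d e \<longleftrightarrow>
     (\<forall>n\<ge>1. strongly_measurable M (e n)) \<and>
     (\<forall>n\<ge>1. \<forall>B\<in>sets borel. AE \<omega> in M.
        cond_probability M (F (n - 1)) {\<omega>\<in>space M. d n \<omega> \<in> B} \<omega> =
        cond_probability M (filtration_limit M F) {\<omega>\<in>space M. e n \<omega> \<in> B} \<omega>) \<and>
     (\<forall>n\<ge>1. \<forall>B. (\<forall>k\<in>{1..n}. B k \<in> sets borel) \<longrightarrow> (AE \<omega> in M.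
        cond_probability M (filtration_limit M F) {\<omega>\<in>space M. \<forall>k\<in>{1..n}. e k \<omega> \<in> B k} \<omega> =
        (\<Prod>k\<in>{1..n}. cond_probability M (filtration_limit M F) {\<omega>\<in>space M. e k \<omega> \<in> B k} \<omega>)))"

definition decoupled_sum ::
  "'a measure \<Rightarrow> (nat \<Rightarrow> 'a measure) \<Rightarrow> (nat \<Rightarrow> 'a \<Rightarrow> 'x::real_normed_vector) \<Rightarrow> (nat \<Rightarrow> 'a \<Rightarrow> 'x) \<Rightarrow> bool"
where
  "decoupled_sum M F f g \<longleftrightarrow> decoupled_tangent M F (increments f) (increments g)"

text \<open>The \<open>L\<^sup>p\<close> norm for \<open>1 \<le> p \<le> \<infinity>\<close>, with value \<open>\<infinity>\<close> outside \<open>L\<^sup>p\<close>.\<close>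

definition Lp_norm :: "'a measure \<Rightarrow> ennreal \<Rightarrow> ('a \<Rightarrow> 'x::real_normed_vector) \<Rightarrow> ennreal" where
  "Lp_norm M p f =
     (if p = \<infinity> then esssup M (\<lambda>\<omega>. ennreal (norm (f \<omega>)))
      else let I = (\<integral>\<^sup>+ \<omega>. ennreal (norm (f \<omega>) powr enn2real p) \<partial>M) in
        if I = \<infinity> then \<infinity> else ennreal (enn2real I powr (1 / enn2real p)))"

definition in_Lp :: "'a measure \<Rightarrow> ennreal \<Rightarrow> ('a \<Rightarrow> 'x::real_normed_vector) \<Rightarrow> bool" where
  "in_Lp M p f \<longleftrightarrow> strongly_measurable M f \<and> Lp_norm M p f < \<infinity>"

text \<open>
  The least constant \<open>D\<^sub>p(X)\<close>, with \<open>X\<close> the type \<open>'x\<close>. HOL cannot quantify over types inside a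
  formula, so the probability spaces range over all measures whose underlying set is a subset of
  the type \<open>'a\<close>, which acts as the universe of sample points.
\<close>

definition decoupling_constant :: "'a itself \<Rightarrow> 'x::real_normed_vector itself \<Rightarrow> ennreal \<Rightarrow> ennreal" where
  "decoupling_constant _ _ p = Inf {C.
     \<forall>(M :: 'a measure) F (f :: nat \<Rightarrow> 'a \<Rightarrow> 'x) g.
       complete_filtered_prob_space M F \<longrightarrow> adapted_seq F f \<longrightarrow> (\<forall>n\<ge>1. in_Lp M p (f n)) \<longrightarrow>
       decoupled_sum M F f g \<longrightarrow>
       (\<forall>n\<ge>1. Lp_norm M p (f n) \<le> C * Lp_norm M p (g n))}"

definition real_decoupling_constant :: "'a itself \<Rightarrow> ennreal" where
  "real_decoupling_constant \<Omega> = (SUP p\<in>{1..\<infinity>}. decoupling_constant \<Omega> TYPE(real) p)"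

end

theory Submission
  imports Defs
begin

text \<open>
  For a fixed vector \<open>y\<close> the scalar process \<open>\<langle>f\<^sub>n, y\<rangle>\<close> has the decoupled sum sequence \<open>\<langle>g\<^sub>n, y\<rangle>\<close>
  over the same filtered space, so the real inequality applies to it. Let \<open>y\<close> be a standard Gaussian
  vector in a finite-dimensional subspace and integrate the \<open>r\<close>-th power over \<open>y\<close>: since
  \<open>E \<bar>\<langle>x, y\<rangle>\<bar>\<^sup>r = m\<^sub>r \<parallel>P x\<parallel>\<^sup>r\<close> with \<open>P\<close> the orthogonal projection and \<open>0 < m\<^sub>r < \<infinity>\<close>, Fubini's theorem
  yields the inequality for \<open>P f\<^sub>n\<close> and \<open>P g\<^sub>n\<close> with the same constant. Separability of the range of
  \<open>f\<^sub>n\<close> and Fatou's lemma remove the projection. The case \<open>p = \<infinity>\<close> follows by letting \<open>r \<rightarrow> \<infinity>\<close>, which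
  is why the supremum over all exponents enters.
\<close>

subsection \<open>Absolute moments of Gaussian linear forms\<close>

abbreviation std_gaussian :: "real measure" where
  "std_gaussian \<equiv> density lborel (\<lambda>x. ennreal (std_normal_density x))"

text \<open>A linear combination of independent standard normals is centred normal with variance the
  sum of the squared coefficients. Dividing by its standard deviation gives a standard normal
  variable, and homogeneity of the \<open>r\<close>-th power pulls the scale out.\<close>

lemma gaussian_linear_form_moment:
  fixes a :: "'i \<Rightarrow> real"
  assumes "finite C" "r > 0"
  shows "(\<integral>\<^sup>+ s. ennreal (\<bar>\<Sum>c\<in>C. a c * s c\<bar> powr r) \<partial>(\<Pi>\<^sub>M c\<in>C. std_gaussian)) =
    (\<integral>\<^sup>+ t. ennreal (\<bar>t\<bar> powr r) \<partial>std_gaussian) * ennreal (sqrt (\<Sum>c\<in>C. (a c)\<^sup>2) powr r)"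
proof -
  let ?N = "\<lambda>c::'i. std_gaussian"
  have N: "prob_space std_gaussian" by (simp add: prob_space_normal_density)
  interpret P: product_prob_space ?N C
    using N by (simp add: product_prob_space_def product_prob_space_axioms_def product_sigma_finite_def
        prob_space_imp_sigma_finite)
  let ?P = "\<Pi>\<^sub>M c\<in>C. std_gaussian"
  \<comment> \<open>Terms with zero coefficient are degenerate rather than normal, so they are
    dropped first. If none remain, both sides vanish because \<open>0 powr r = 0\<close>.\<close>
  define I where "I = {c\<in>C. a c \<noteq> 0}"
  have I: "finite I" "I \<subseteq> C" using assms by (auto simp: I_def)
  have sumI: "(\<Sum>c\<in>C. a c * s c) = (\<Sum>c\<in>I. a c * s c)" for s :: "'i \<Rightarrow> real"
    using assms by (intro sum.mono_neutral_right) (auto simp: I_def)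
  have sumI2: "(\<Sum>c\<in>C. (a c)\<^sup>2) = (\<Sum>c\<in>I. \<bar>a c\<bar>\<^sup>2)"
    using assms by (simp, intro sum.mono_neutral_right) (auto simp: I_def)
  show ?thesis
  proof (cases "I = {}")
    case True
    then show ?thesis unfolding sumI sumI2 using assms by simp
  next
    case False
    have meas[measurable]: "(\<lambda>s. s c) \<in> borel_measurable ?P" if "c \<in> C" for c
      using measurable_component_singleton[OF that, of ?N]
      by (simp add: measurable_cong_sets[OF refl sets_density])
    have sets_P: "sets (PiM C (\<lambda>c. borel :: real measure)) = sets ?P"
      by (intro sets_PiM_cong) auto
    have comp: "distr ?P borel (\<lambda>s. s c) = std_gaussian" if "c \<in> C" for c
    proof -
      have "distr ?P borel (\<lambda>s. s c) = distr ?P std_gaussian (\<lambda>s. s c)"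
        by (intro distr_cong) auto
      also have "\<dots> = std_gaussian"
        using distr_PiM_component[of C ?N c] N that by simp
      finally show ?thesis .
    qed
    \<comment> \<open>The coordinates are independent because their joint law, the product measure
      itself, is the product of their marginals.\<close>
    have "P.indep_vars (\<lambda>c. borel) (\<lambda>c s. s c) C"
    proof (subst P.indep_vars_iff_distr_eq_PiM')
      show "C \<noteq> {}" using False I by auto
      show "(\<lambda>s. s c) \<in> borel_measurable ?P" if "c \<in> C" for c using that by (rule meas)
      have "distr ?P (PiM C (\<lambda>c. borel)) (\<lambda>x. \<lambda>c\<in>C. x c) = distr ?P ?P (\<lambda>x. x)"
        by (intro distr_cong sets_P refl) (auto simp: space_PiM PiE_restrict)
      also have "\<dots> = PiM C (\<lambda>c. distr ?P borel (\<lambda>s. s c))"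
        by (simp add: distr_id cong: PiM_cong) (intro PiM_cong, auto simp: comp)
      finally show "distr ?P (PiM C (\<lambda>c. borel)) (\<lambda>x. \<lambda>c\<in>C. x c) = PiM C (\<lambda>c. distr ?P borel (\<lambda>s. s c))" .
    qed
    then have "P.indep_vars (\<lambda>c. borel) (\<lambda>c s. s c) I"
      by (rule P.indep_vars_subset) (use I in auto)
    then have indep: "P.indep_vars (\<lambda>c. borel) (\<lambda>c s. a c * s c) I"
      by (rule P.indep_vars_compose2) auto
    have normal: "distributed ?P lborel (\<lambda>s. a c * s c) (normal_density 0 \<bar>a c\<bar>)" if "c \<in> I" for c
    proof -
      have cC: "c \<in> C" using that I by auto
      have "distributed ?P lborel (\<lambda>s. s c) std_normal_density"
        unfolding distributed_def using comp[OF cC] meas[OF cC]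
        by (auto intro!: distr_cong simp: distr_cong[OF refl sets_lborel])
      from P.normal_density_affine[OF this, of "a c" 0] show ?thesis
        using that by (simp add: I_def)
    qed
    let ?\<sigma> = "sqrt (\<Sum>c\<in>I. \<bar>a c\<bar>\<^sup>2)"
    have pos: "?\<sigma> > 0"
      using False I by (auto simp: I_def intro!: sum_pos)
    have D: "distributed ?P lborel (\<lambda>s. \<Sum>c\<in>I. a c * s c) (normal_density 0 ?\<sigma>)"
      using P.sum_indep_normal[OF \<open>finite I\<close> False indep _ normal] by (auto simp: I_def)
    have std: "distributed ?P lborel (\<lambda>s. (\<Sum>c\<in>I. a c * s c) / ?\<sigma>) std_normal_density"
      using P.normal_density_affine[OF D pos, of "1 / ?\<sigma>" 0] pos by simp
    have [measurable]: "(\<lambda>s. s c) \<in> borel_measurable ?P" if "c \<in> I" for c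
      using that I by (intro meas) auto
    have "(\<integral>\<^sup>+ s. ennreal (\<bar>\<Sum>c\<in>I. a c * s c\<bar> powr r) \<partial>?P) =
        (\<integral>\<^sup>+ s. ennreal (\<bar>(\<Sum>c\<in>I. a c * s c) / ?\<sigma>\<bar> powr r) * ennreal (?\<sigma> powr r) \<partial>?P)"
      using pos by (intro nn_integral_cong)
        (simp add: ennreal_mult'[symmetric] powr_mult[symmetric] del: power2_abs)
    also have "\<dots> = (\<integral>\<^sup>+ s. ennreal (\<bar>(\<Sum>c\<in>I. a c * s c) / ?\<sigma>\<bar> powr r) \<partial>?P) * ennreal (?\<sigma> powr r)"
      by (intro nn_integral_multc) measurable
    also have "(\<integral>\<^sup>+ s. ennreal (\<bar>(\<Sum>c\<in>I. a c * s c) / ?\<sigma>\<bar> powr r) \<partial>?P) =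
        (\<integral>\<^sup>+ t. ennreal (std_normal_density t) * ennreal (\<bar>t\<bar> powr r) \<partial>lborel)"
      by (rule distributed_nn_integral[OF std, symmetric]) simp
    also have "\<dots> = (\<integral>\<^sup>+ t. ennreal (\<bar>t\<bar> powr r) \<partial>std_gaussian)"
      by (rule nn_integral_density[symmetric]) auto
    finally show ?thesis unfolding sumI sumI2 .
  qed
qed

text \<open>The density is positive and the integrand vanishes only at 0. A zero integral would
  therefore make the complement of the origin a Lebesgue null set, against the length of
  \<open>{1..2}\<close>.\<close>

lemma gaussian_absolute_moment_pos:
  assumes "r > 0"
  shows "(\<integral>\<^sup>+ t. ennreal (\<bar>t\<bar> powr r) \<partial>std_gaussian) \<noteq> 0"
proof
  assume "(\<integral>\<^sup>+ t. ennreal (\<bar>t\<bar> powr r) \<partial>std_gaussian) = 0"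
  then have "AE t in std_gaussian. ennreal (\<bar>t\<bar> powr r) = 0"
    by (subst (asm) nn_integral_0_iff_AE) auto
  then have "AE t in lborel. t = (0::real)"
    by (subst (asm) AE_density) (auto simp: normal_density_pos)
  then have "AE t in lborel. t \<notin> {1..2::real}"
    by eventually_elim auto
  then have "emeasure lborel {1..2::real} = 0"
    by (subst (asm) AE_iff_measurable[of "{1..2}"]) auto
  moreover have "emeasure lborel {1..2::real} = 1" by simp
  ultimately show False by simp
qed

text \<open>For an integer \<open>k\<close> above \<open>r\<close>, the integrand is dominated by
  \<open>1 + \<bar>t\<bar> ^ k\<close>, whose two terms have finite Gaussian integrals.\<close>

lemma gaussian_absolute_moment_finite:
  assumes "r > 0"
  shows "(\<integral>\<^sup>+ t. ennreal (\<bar>t\<bar> powr r) \<partial>std_gaussian) < \<infinity>"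
proof -
  obtain k :: nat where k: "r \<le> real k" using real_arch_simple by blast
  have le: "\<bar>t\<bar> powr r \<le> 1 + \<bar>t\<bar> ^ k" for t :: real
  proof (cases "\<bar>t\<bar> \<ge> 1")
    case True
    then have "\<bar>t\<bar> powr r \<le> \<bar>t\<bar> powr k" using k by (intro powr_mono) auto
    moreover have "\<bar>t\<bar> powr k = \<bar>t\<bar> ^ k" using True by (intro powr_realpow) auto
    ultimately show ?thesis by simp
  next
    case False
    then have "\<bar>t\<bar> powr r \<le> 1" using assms by (intro powr_le1) auto
    then show ?thesis by (simp add: add_increasing2)
  qed
  have "(\<integral>\<^sup>+ t. ennreal (\<bar>t\<bar> powr r) \<partial>std_gaussian) =
      (\<integral>\<^sup>+ t. ennreal (std_normal_density t) * ennreal (\<bar>t\<bar> powr r) \<partial>lborel)"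
    by (rule nn_integral_density) auto
  also have "\<dots> \<le> (\<integral>\<^sup>+ t. ennreal (std_normal_density t * \<bar>t\<bar> ^ 0 + std_normal_density t * \<bar>t\<bar> ^ k) \<partial>lborel)"
  proof (rule nn_integral_mono)
    fix t :: real
    have "std_normal_density t * \<bar>t\<bar> powr r \<le> std_normal_density t * (1 + \<bar>t\<bar> ^ k)"
      by (intro mult_left_mono le) simp
    then show "ennreal (std_normal_density t) * ennreal (\<bar>t\<bar> powr r) \<le>
        ennreal (std_normal_density t * \<bar>t\<bar> ^ 0 + std_normal_density t * \<bar>t\<bar> ^ k)"
      by (simp add: ennreal_mult'[symmetric] distrib_left ennreal_leI del: ennreal_plus)
  qed
  also have "\<dots> < \<infinity>"
    using Bochner_Integration.integrable_add[OF integrable_std_normal_moment_abs[of 0]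
        integrable_std_normal_moment_abs[of k]]
    by (subst (asm) integrable_iff_bounded) (simp add: abs_mult)
  finally show ?thesis .
qed

subsection \<open>From scalar inequalities to norm inequalities\<close>

text \<open>The set serves as its own index set, so that Gaussian coordinates can later be indexed
  by the basis vectors.\<close>

definition orthonormal :: "'x::real_inner set \<Rightarrow> bool" where
  "orthonormal C \<longleftrightarrow> finite C \<and> (\<forall>b\<in>C. \<forall>c\<in>C. b \<bullet> c = (if b = c then 1 else 0))"

definition orth_proj :: "'x::real_inner set \<Rightarrow> 'x \<Rightarrow> 'x" where
  "orth_proj C x = (\<Sum>c\<in>C. (x \<bullet> c) *\<^sub>R c)"

text \<open>Gram-Schmidt yields a pairwise orthogonal set, possibly containing 0. Discarding 0 and
  rescaling to unit length keeps the span.\<close>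

lemma finite_span_orthonormal:
  fixes B :: "'x::real_inner set"
  assumes "finite B"
  obtains C where "orthonormal C" "B \<subseteq> span C"
proof -
  obtain C0 where C0: "finite C0" "span C0 = span B" "pairwise orthogonal C0"
    using basis_orthogonal[OF assms] by blast
  define C where "C = (\<lambda>c. c /\<^sub>R norm c) ` (C0 - {0})"
  have "orthonormal C"
    unfolding orthonormal_def
  proof (intro conjI ballI)
    show "finite C" using C0 by (simp add: C_def)
    fix b c assume "b \<in> C" "c \<in> C"
    then obtain b' c' where bc: "b' \<in> C0" "c' \<in> C0" "b' \<noteq> 0" "c' \<noteq> 0"
      "b = b' /\<^sub>R norm b'" "c = c' /\<^sub>R norm c'" by (auto simp: C_def)
    have "b \<bullet> b = 1"
      using bc by (simp add: dot_square_norm power2_eq_square)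
    moreover have "b \<bullet> c = 0" if "b \<noteq> c"
      using C0(3) bc that unfolding pairwise_def orthogonal_def by auto
    ultimately show "b \<bullet> c = (if b = c then 1 else 0)" by auto
  qed
  moreover have "B \<subseteq> span C"
  proof -
    have "c \<in> span C" if "c \<in> C0" for c
    proof (cases "c = 0")
      case False
      then have "norm c *\<^sub>R (c /\<^sub>R norm c) \<in> span C"
        using that by (intro span_scale span_base) (auto simp: C_def)
      then show ?thesis using False by simp
    qed (simp add: span_zero)
    then have "span C0 \<subseteq> span C" by (simp add: span_minimal subsetI)
    then show ?thesis using C0(2) span_superset by blast
  qed
  ultimately show thesis by (rule that)
qed

lemma orthonormal_finite: "orthonormal C \<Longrightarrow> finite C"
  by (simp add: orthonormal_def)

lemma norm_orth_proj:
  assumes "orthonormal C"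
  shows "norm (orth_proj C x) = sqrt (\<Sum>c\<in>C. (x \<bullet> c)\<^sup>2)"
proof -
  have "orth_proj C x \<bullet> orth_proj C x = (\<Sum>b\<in>C. \<Sum>c\<in>C. (x \<bullet> b) * ((x \<bullet> c) * (b \<bullet> c)))"
    by (simp add: orth_proj_def inner_sum_left inner_sum_right sum_distrib_left inner_commute mult_ac)
  also have "\<dots> = (\<Sum>b\<in>C. \<Sum>c\<in>C. if b = c then (x \<bullet> b)\<^sup>2 else 0)"
    using assms by (intro sum.cong refl) (auto simp: orthonormal_def power2_eq_square)
  also have "\<dots> = (\<Sum>c\<in>C. (x \<bullet> c)\<^sup>2)"
    using assms by (simp add: orthonormal_def)
  finally show ?thesis by (simp add: norm_eq_sqrt_inner)
qed

text \<open>The squared norm of the projection equals its inner product with \<open>x\<close>;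
  Cauchy-Schwarz then allows one factor to be cancelled.\<close>

lemma norm_orth_proj_le:
  assumes "orthonormal C"
  shows "norm (orth_proj C x) \<le> norm x"
proof -
  have "norm (orth_proj C x) ^ 2 = x \<bullet> orth_proj C x"
    unfolding norm_orth_proj[OF assms] by (simp add: orth_proj_def inner_sum_right power2_eq_square sum_nonneg)
  also have "\<dots> \<le> norm x * norm (orth_proj C x)" by (rule norm_cauchy_schwarz)
  finally show ?thesis
    by (cases "norm (orth_proj C x) = 0") (auto simp: power2_eq_square)
qed

lemma orth_proj_span:
  assumes C: "orthonormal C" and y: "y \<in> span C"
  shows "orth_proj C y = y"
  using y
proof (induction rule: span_induct_alt)
  case base
  then show ?case by (simp add: orth_proj_def)
next
  case (step k b z)
  have "orth_proj C (k *\<^sub>R b + z) = k *\<^sub>R orth_proj C b + orth_proj C z"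
    by (simp add: orth_proj_def inner_add_left scaleR_add_left sum.distrib scaleR_sum_right)
  moreover have "orth_proj C b = (\<Sum>c\<in>C. if b = c then c else 0)"
    unfolding orth_proj_def using C step by (intro sum.cong refl) (auto simp: orthonormal_def)
  ultimately show ?case using C step by (simp add: orthonormal_def)
qed

text \<open>Split \<open>x = (x - y) + y\<close>, where the projection fixes \<open>y\<close> and
  contracts \<open>x - y\<close>. This makes the projected norms converge once the spans come
  arbitrarily close to \<open>x\<close>.\<close>

lemma norm_le_orth_proj:
  assumes C: "orthonormal C" and y: "y \<in> span C"
  shows "norm x \<le> norm (orth_proj C x) + 2 * norm (x - y)"
proof -
  have "norm x \<le> norm (x - y) + norm (orth_proj C y)"
    using norm_triangle_ineq[of "x - y" y] orth_proj_span[OF C y] by simp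
  also have "orth_proj C y = orth_proj C x - orth_proj C (x - y)"
    by (simp add: orth_proj_def inner_diff_left scaleR_diff_left sum_subtractf)
  also have "norm \<dots> \<le> norm (orth_proj C x) + norm (x - y)"
    using norm_triangle_ineq4[of "orth_proj C x" "orth_proj C (x - y)"] norm_orth_proj_le[OF C, of "x - y"]
    by linarith
  finally show ?thesis by simp
qed

section \<open>Averaging over Gaussian directions and exhausting a separable range\<close>

text \<open>The hypothesis is integrated over the random direction
  \<open>y = (\<Sum>c\<in>C. s c *\<^sub>R c)\<close> with independent standard normal
  \<open>s c\<close>. Tonelli's theorem turns each side into the same Gaussian moment times the
  integral of the projected norm.\<close>

lemma nn_integral_orth_proj_le:
  fixes u v :: "'a \<Rightarrow> 'x::real_inner"
  assumes C: "orthonormal C" and "r > 0" and M: "sigma_finite_measure M"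
    and u[measurable]: "\<And>y. (\<lambda>\<omega>. u \<omega> \<bullet> y) \<in> borel_measurable M"
    and v[measurable]: "\<And>y. (\<lambda>\<omega>. v \<omega> \<bullet> y) \<in> borel_measurable M"
    and le: "\<And>y. (\<integral>\<^sup>+\<omega>. ennreal (\<bar>u \<omega> \<bullet> y\<bar> powr r) \<partial>M) \<le> K * (\<integral>\<^sup>+\<omega>. ennreal (\<bar>v \<omega> \<bullet> y\<bar> powr r) \<partial>M)"
  shows "(\<integral>\<^sup>+\<omega>. ennreal (norm (orth_proj C (u \<omega>)) powr r) \<partial>M)
    \<le> K * (\<integral>\<^sup>+\<omega>. ennreal (norm (orth_proj C (v \<omega>)) powr r) \<partial>M)"
proof -
  let ?P = "\<Pi>\<^sub>M c\<in>C. std_gaussian"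
  let ?m = "\<integral>\<^sup>+ t. ennreal (\<bar>t\<bar> powr r) \<partial>std_gaussian"
  have fin: "finite C" using C by (rule orthonormal_finite)
  have "prob_space ?P" by (intro prob_space_PiM) (simp add: prob_space_normal_density)
  then have P: "sigma_finite_measure ?P" by (rule prob_space_imp_sigma_finite)
  interpret pair_sigma_finite M ?P using M P by (simp add: pair_sigma_finite_def)
  have coord[measurable]: "(\<lambda>s. s c) \<in> borel_measurable ?P" if "c \<in> C" for c
    using measurable_component_singleton[OF that, of "\<lambda>c. std_gaussian"]
    by (simp add: measurable_cong_sets[OF refl sets_density])
  have avg: "?m * (\<integral>\<^sup>+\<omega>. ennreal (norm (orth_proj C (w \<omega>)) powr r) \<partial>M) =
      (\<integral>\<^sup>+ s. \<integral>\<^sup>+\<omega>. ennreal (\<bar>w \<omega> \<bullet> (\<Sum>c\<in>C. s c *\<^sub>R c)\<bar> powr r) \<partial>M \<partial>?P)"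
    if w[measurable]: "\<And>y. (\<lambda>\<omega>. w \<omega> \<bullet> y) \<in> borel_measurable M" for w :: "'a \<Rightarrow> 'x"
  proof -
    have eq: "w \<omega> \<bullet> (\<Sum>c\<in>C. s c *\<^sub>R c) = (\<Sum>c\<in>C. (w \<omega> \<bullet> c) * s c)" for \<omega> and s :: "'x \<Rightarrow> real"
      by (simp add: inner_sum_right mult.commute)
    have meas: "(\<lambda>(\<omega>, s). ennreal (\<bar>\<Sum>c\<in>C. (w \<omega> \<bullet> c) * s c\<bar> powr r)) \<in> borel_measurable (M \<Otimes>\<^sub>M ?P)"
      by measurable
    have "(\<integral>\<^sup>+ s. \<integral>\<^sup>+\<omega>. ennreal (\<bar>w \<omega> \<bullet> (\<Sum>c\<in>C. s c *\<^sub>R c)\<bar> powr r) \<partial>M \<partial>?P) =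
        (\<integral>\<^sup>+\<omega>. \<integral>\<^sup>+ s. ennreal (\<bar>\<Sum>c\<in>C. (w \<omega> \<bullet> c) * s c\<bar> powr r) \<partial>?P \<partial>M)"
      unfolding eq by (rule Fubini'[OF meas])
    also have "\<dots> = (\<integral>\<^sup>+\<omega>. ?m * ennreal (norm (orth_proj C (w \<omega>)) powr r) \<partial>M)"
      unfolding gaussian_linear_form_moment[OF fin \<open>r > 0\<close>] norm_orth_proj[OF C] ..
    also have "\<dots> = ?m * (\<integral>\<^sup>+\<omega>. ennreal (norm (orth_proj C (w \<omega>)) powr r) \<partial>M)"
      unfolding norm_orth_proj[OF C] by (intro nn_integral_cmult) measurable
    finally show ?thesis ..
  qed
  have measv: "(\<lambda>(s, \<omega>). ennreal (\<bar>v \<omega> \<bullet> (\<Sum>c\<in>C. s c *\<^sub>R c)\<bar> powr r)) \<in> borel_measurable (?P \<Otimes>\<^sub>M M)"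
    unfolding inner_sum_right inner_scaleR_right by measurable
  have "?m * (\<integral>\<^sup>+\<omega>. ennreal (norm (orth_proj C (u \<omega>)) powr r) \<partial>M) \<le>
      (\<integral>\<^sup>+ s. K * (\<integral>\<^sup>+\<omega>. ennreal (\<bar>v \<omega> \<bullet> (\<Sum>c\<in>C. s c *\<^sub>R c)\<bar> powr r) \<partial>M) \<partial>?P)"
    unfolding avg[OF u] by (intro nn_integral_mono le)
  also have "\<dots> = K * (\<integral>\<^sup>+ s. (\<integral>\<^sup>+\<omega>. ennreal (\<bar>v \<omega> \<bullet> (\<Sum>c\<in>C. s c *\<^sub>R c)\<bar> powr r) \<partial>M) \<partial>?P)"
    by (intro nn_integral_cmult sigma_finite_measure.borel_measurable_nn_integral[OF M] measv)
  also have "\<dots> = ?m * (K * (\<integral>\<^sup>+\<omega>. ennreal (norm (orth_proj C (v \<omega>)) powr r) \<partial>M))"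
    unfolding avg[OF v, symmetric] by (simp add: mult_ac)
  \<comment> \<open>The Gaussian moment is neither 0 nor infinite, so it cancels.\<close>
  finally show ?thesis
    using gaussian_absolute_moment_pos[OF \<open>r > 0\<close>] gaussian_absolute_moment_finite[OF \<open>r > 0\<close>]
    by (subst (asm) ennreal_mult_le_mult_iff) auto
qed

text \<open>
  The norm of \<open>v\<close> may fail to be measurable when the space is not separable; only monotonicity of
  the integral is used for it.
\<close>

lemma nn_integral_norm_powr_le_of_inner:
  fixes u v :: "'a \<Rightarrow> 'x::real_inner"
  assumes r: "r > 0" and M: "sigma_finite_measure M"
    and u: "strongly_measurable M u"
    and v: "\<And>y. (\<lambda>\<omega>. v \<omega> \<bullet> y) \<in> borel_measurable M"
    and le: "\<And>y. (\<integral>\<^sup>+\<omega>. ennreal (\<bar>u \<omega> \<bullet> y\<bar> powr r) \<partial>M) \<le> K * (\<integral>\<^sup>+\<omega>. ennreal (\<bar>v \<omega> \<bullet> y\<bar> powr r) \<partial>M)"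
  shows "(\<integral>\<^sup>+\<omega>. ennreal (norm (u \<omega>) powr r) \<partial>M) \<le> K * (\<integral>\<^sup>+\<omega>. ennreal (norm (v \<omega>) powr r) \<partial>M)"
proof (cases "space M = {}")
  case True
  then show ?thesis by (simp add: nn_integral_empty)
next
  case False
  have um[measurable]: "u \<in> borel_measurable M" using u by (simp add: strongly_measurable_def)
  obtain D where D: "countable D" "D \<subseteq> u ` space M" "u ` space M \<subseteq> closure D"
    using u unfolding strongly_measurable_def separable_space_def
    by (auto simp: closure_of_subtopology Int_absorb1)
  \<comment> \<open>\<open>from_nat_into\<close> enumerates only nonempty countable sets, which is
    why the empty space was treated separately.\<close>
  with False have "D \<noteq> {}" by auto
  \<comment> \<open>The finite sets \<open>B N\<close> increase to \<open>D\<close>, so each point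
    of \<open>D\<close> lies in the span of \<open>C N\<close> for all large \<open>N\<close>; the
    bases \<open>C N\<close> themselves need not be nested.\<close>
  define B where "B N = from_nat_into D ` {..N::nat}" for N
  have "\<exists>C. orthonormal C \<and> B N \<subseteq> span C" for N
    using finite_span_orthonormal[of "B N"] by (metis B_def finite_atMost finite_imageI)
  then obtain C where C: "\<And>N. orthonormal (C N)" "\<And>N. B N \<subseteq> span (C N)" by metis
  have lim: "(\<lambda>N. norm (orth_proj (C N) (u \<omega>))) \<longlonglongrightarrow> norm (u \<omega>)" if \<omega>: "\<omega> \<in> space M" for \<omega>
  proof (rule LIMSEQ_I)
    fix e :: real assume "e > 0"
    have "u \<omega> \<in> closure D" using D \<omega> by auto
    \<comment> \<open>The radius \<open>e / 2\<close> absorbs the factor 2 in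
      \<open>norm_le_orth_proj\<close>.\<close>
    then obtain y where y: "y \<in> D" "dist y (u \<omega>) < e / 2"
      using \<open>e > 0\<close> unfolding closure_approachable by (meson half_gt_zero)
    then obtain k where k: "y = from_nat_into D k"
      using D(1) by (metis from_nat_into_surj)
    have "norm (norm (orth_proj (C N) (u \<omega>)) - norm (u \<omega>)) < e" if "N \<ge> k" for N
    proof -
      have "y \<in> span (C N)" using C(2)[of N] that k by (auto simp: B_def)
      from norm_le_orth_proj[OF C(1) this, of "u \<omega>"] norm_orth_proj_le[OF C(1), of N "u \<omega>"] y
      show ?thesis by (simp add: dist_norm norm_minus_commute)
    qed
    then show "\<exists>no. \<forall>N\<ge>no. norm (norm (orth_proj (C N) (u \<omega>)) - norm (u \<omega>)) < e" by blast
  qed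
  have inner_u: "(\<lambda>\<omega>. u \<omega> \<bullet> y) \<in> borel_measurable M" for y
    by (rule borel_measurable_continuous_on[OF _ um]) (intro continuous_intros)
  have "(\<integral>\<^sup>+\<omega>. ennreal (norm (u \<omega>) powr r) \<partial>M) =
      (\<integral>\<^sup>+\<omega>. liminf (\<lambda>N. ennreal (norm (orth_proj (C N) (u \<omega>)) powr r)) \<partial>M)"
  proof (rule nn_integral_cong)
    fix \<omega> assume "\<omega> \<in> space M"
    then have "(\<lambda>N. ennreal (norm (orth_proj (C N) (u \<omega>)) powr r)) \<longlonglongrightarrow> ennreal (norm (u \<omega>) powr r)"
      using r by (intro tendsto_ennrealI tendsto_powr2 lim tendsto_const) auto
    then show "ennreal (norm (u \<omega>) powr r) = liminf (\<lambda>N. ennreal (norm (orth_proj (C N) (u \<omega>)) powr r))"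
      by (metis lim_imp_Liminf trivial_limit_sequentially)
  qed
  also have "\<dots> \<le> liminf (\<lambda>N. \<integral>\<^sup>+\<omega>. ennreal (norm (orth_proj (C N) (u \<omega>)) powr r) \<partial>M)"
    unfolding norm_orth_proj[OF C(1)] using inner_u by (intro nn_integral_liminf) measurable
  \<comment> \<open>On the right the projections are removed by contraction, which bounds every
    member of the sequence by the same quantity.\<close>
  also have "\<dots> \<le> K * (\<integral>\<^sup>+\<omega>. ennreal (norm (v \<omega>) powr r) \<partial>M)"
  proof (rule Liminf_le, simp, intro always_eventually allI)
    fix N
    have "(\<integral>\<^sup>+\<omega>. ennreal (norm (orth_proj (C N) (u \<omega>)) powr r) \<partial>M) \<le>
        K * (\<integral>\<^sup>+\<omega>. ennreal (norm (orth_proj (C N) (v \<omega>)) powr r) \<partial>M)"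
      by (intro nn_integral_orth_proj_le C r M inner_u v le)
    also have "\<dots> \<le> K * (\<integral>\<^sup>+\<omega>. ennreal (norm (v \<omega>) powr r) \<partial>M)"
      using r by (intro mult_left_mono nn_integral_mono ennreal_leI powr_mono2 norm_orth_proj_le C) auto
    finally show "(\<integral>\<^sup>+\<omega>. ennreal (norm (orth_proj (C N) (u \<omega>)) powr r) \<partial>M) \<le> \<dots>" .
  qed
  finally show ?thesis .
qed

subsection \<open>Decoupling inequalities\<close>

text \<open>An infinite integral falsifies both sides since \<open>c\<close> is finite; otherwise
  the \<open>r\<close>-th power is monotone. No measurability of \<open>f\<close> enters.\<close>

lemma Lp_norm_le_iff:
  assumes "r > 0" "c \<ge> 0"
  shows "Lp_norm M (ennreal r) f \<le> ennreal c \<longleftrightarrow>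
    (\<integral>\<^sup>+\<omega>. ennreal (norm (f \<omega>) powr r) \<partial>M) \<le> ennreal (c powr r)"
proof (cases "\<integral>\<^sup>+\<omega>. ennreal (norm (f \<omega>) powr r) \<partial>M")
  case (real i)
  have "i powr (1 / r) \<le> c \<longleftrightarrow> (i powr (1 / r)) powr r \<le> c powr r"
    using assms powr_mono2[of r "i powr (1 / r)" c] powr_less_mono2[of r c "i powr (1 / r)"]
    by (auto simp: not_le[symmetric])
  then show ?thesis using assms real by (simp add: Lp_norm_def powr_powr)
next
  case top
  then show ?thesis using assms by (simp add: Lp_norm_def top_unique)
qed

lemma (in prob_space) Lp_norm_le_Lp_norm_infinity:
  assumes "r > 0"
  shows "Lp_norm M (ennreal r) f \<le> Lp_norm M \<infinity> f"
proof (cases "Lp_norm M \<infinity> f")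
  case (real k)
  have "AE \<omega> in M. ennreal (norm (f \<omega>)) \<le> ennreal k"
    using esssup_AE[of "\<lambda>\<omega>. ennreal (norm (f \<omega>))" M] real by (simp add: Lp_norm_def)
  then have "(\<integral>\<^sup>+\<omega>. ennreal (norm (f \<omega>) powr r) \<partial>M) \<le> (\<integral>\<^sup>+\<omega>. ennreal (k powr r) \<partial>M)"
    using real assms
    by (intro nn_integral_mono_AE) (auto elim!: eventually_mono intro!: ennreal_leI powr_mono2)
  then show ?thesis
    using real assms by (simp add: Lp_norm_le_iff emeasure_space_1)
qed simp

text \<open>For \<open>a > c\<close>, Markov's inequality for the \<open>n\<close>-th power bounds
  the probability of \<open>norm (f \<omega>) \<ge> a\<close> by \<open>(c / a) ^ n\<close>, which
  tends to 0.\<close>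

lemma (in prob_space) Lp_norm_infinity_le:
  assumes f[measurable]: "f \<in> borel_measurable M" and "c \<ge> 0"
    and le: "\<And>r. r \<ge> 1 \<Longrightarrow> Lp_norm M (ennreal r) f \<le> ennreal c"
  shows "Lp_norm M \<infinity> f \<le> ennreal c"
proof -
  have AE_less: "AE \<omega> in M. norm (f \<omega>) < a" if "a > c" for a
  proof -
    let ?A = "{\<omega>\<in>space M. a \<le> norm (f \<omega>)}"
    have a: "a > 0" using that \<open>c \<ge> 0\<close> by simp
    have bound: "emeasure M ?A \<le> ennreal ((c / a) ^ n)" if "n \<ge> 1" for n :: nat
    proof -
      have I: "(\<integral>\<^sup>+\<omega>. ennreal (norm (f \<omega>) powr n) \<partial>M) \<le> ennreal (c powr n)"
        using le[of n] that \<open>c \<ge> 0\<close> by (simp add: Lp_norm_le_iff)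
      have "?A \<subseteq> {\<omega>\<in>space M. 1 \<le> ennreal (1 / a powr n) * ennreal (norm (f \<omega>) powr n)}"
        using a by (auto simp: ennreal_mult'[symmetric] powr_mono2 simp flip: ennreal_1 intro!: ennreal_leI)
      then have "emeasure M ?A \<le> emeasure M {\<omega>\<in>space M. 1 \<le> ennreal (1 / a powr n) * ennreal (norm (f \<omega>) powr n)}"
        by (intro emeasure_mono) auto
      also have "\<dots> \<le> ennreal (1 / a powr n) * (\<integral>\<^sup>+\<omega>. ennreal (norm (f \<omega>) powr n) * indicator (space M) \<omega> \<partial>M)"
        by (rule nn_integral_Markov_inequality) auto
      also have "(\<integral>\<^sup>+\<omega>. ennreal (norm (f \<omega>) powr n) * indicator (space M) \<omega> \<partial>M) =
          (\<integral>\<^sup>+\<omega>. ennreal (norm (f \<omega>) powr n) \<partial>M)"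
        by (intro nn_integral_cong) simp
      also have "ennreal (1 / a powr n) * \<dots> \<le> ennreal (1 / a powr n) * ennreal (c powr n)"
        by (intro mult_left_mono I) simp
      also have "\<dots> = ennreal ((c / a) ^ n)"
        \<comment> \<open>The case \<open>c = 0\<close> is separate because \<open>powr\<close> and
          \<open>^\<close> are identified only for a positive base; both sides are then 0, as
          \<open>n \<ge> 1\<close>.\<close>
        using a \<open>c \<ge> 0\<close> that
        by (cases "c = 0") (auto simp: ennreal_mult'[symmetric] powr_realpow power_divide)
      finally show ?thesis .
    qed
    have "(\<lambda>n. ennreal ((c / a) ^ n)) \<longlonglongrightarrow> ennreal 0"
      using a that \<open>c \<ge> 0\<close> by (intro tendsto_ennrealI LIMSEQ_realpow_zero) auto
    then have "emeasure M ?A \<le> ennreal 0"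
      by (rule LIMSEQ_le_const) (use bound in blast)
    then show ?thesis
      by (subst AE_iff_measurable[of ?A]) (auto simp: not_less)
  qed
  \<comment> \<open>Countably many thresholds decreasing to \<open>c\<close> leave a single null
    set.\<close>
  have "AE \<omega> in M. \<forall>n::nat. norm (f \<omega>) < c + 1 / Suc n"
    unfolding AE_all_countable using AE_less by simp
  then have "AE \<omega> in M. ennreal (norm (f \<omega>)) \<le> ennreal c"
  proof eventually_elim
    case (elim \<omega>)
    have "norm (f \<omega>) \<le> c"
    proof (rule ccontr)
      assume "\<not> norm (f \<omega>) \<le> c"
      then obtain n where "1 / Suc n < norm (f \<omega>) - c"
        using reals_Archimedean[of "norm (f \<omega>) - c"] by (auto simp: inverse_eq_divide)
      with elim[rule_format, of n] show False by simp
    qed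
    then show ?case by (rule ennreal_leI)
  qed
  then show ?thesis unfolding Lp_norm_def by (simp add: esssup_I)
qed

section \<open>Decoupled sequences under continuous and linear maps\<close>

lemma strongly_measurable_compose:
  assumes f: "strongly_measurable M f" and \<phi>: "continuous_on UNIV \<phi>"
  shows "strongly_measurable M (\<lambda>\<omega>. \<phi> (f \<omega>))"
proof -
  have "separable_space (top_of_set ((\<lambda>\<omega>. \<phi> (f \<omega>)) ` space M))"
  proof (rule separable_space_continuous_map_image)
    show "separable_space (top_of_set (f ` space M))" using f by (simp add: strongly_measurable_def)
    show "continuous_map (top_of_set (f ` space M)) (top_of_set ((\<lambda>\<omega>. \<phi> (f \<omega>)) ` space M)) \<phi>"
      using continuous_on_subset[OF \<phi>] by (auto simp: continuous_map_in_subtopology)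
  qed (auto simp: image_image)
  then show ?thesis
    using f borel_measurable_continuous_on[OF \<phi>, of f M] by (simp add: strongly_measurable_def)
qed

lemma strongly_measurable_const: "strongly_measurable M (\<lambda>_. c)"
  unfolding strongly_measurable_def separable_space_def
  by (intro conjI exI[of _ "(\<lambda>_. c) ` space M"]) (auto simp: image_constant_conv closure_of_subtopology)

text \<open>Each event on the transformed sequences is an event on the original ones, with
  \<open>B\<close> replaced by its Borel preimage under \<open>\<phi>\<close>.\<close>

lemma decoupled_tangent_compose:
  assumes e: "decoupled_tangent M F d e" and \<phi>: "continuous_on UNIV \<phi>"
  shows "decoupled_tangent M F (\<lambda>n \<omega>. \<phi> (d n \<omega>)) (\<lambda>n \<omega>. \<phi> (e n \<omega>))"
proof -
  have vimage: "\<phi> -` B \<in> sets borel" if "B \<in> sets borel" for B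
    using measurable_sets[OF borel_measurable_continuous_onI[OF \<phi>] that] by simp
  have indep: "AE \<omega> in M. cond_probability M (filtration_limit M F) {\<omega>\<in>space M. \<forall>k\<in>{1..n}. \<phi> (e k \<omega>) \<in> B k} \<omega> =
        (\<Prod>k\<in>{1..n}. cond_probability M (filtration_limit M F) {\<omega>\<in>space M. \<phi> (e k \<omega>) \<in> B k} \<omega>)"
    if "n \<ge> 1" "\<forall>k\<in>{1..n}. B k \<in> sets borel" for n B
  proof -
    have "\<forall>k\<in>{1..n}. \<phi> -` B k \<in> sets borel" using that(2) vimage by auto
    from e[unfolded decoupled_tangent_def, THEN conjunct2, THEN conjunct2, THEN spec, THEN mp, OF that(1),
        THEN spec, THEN mp, OF this]
    show ?thesis by (simp only: vimage_eq)
  qed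
  have tangent: "AE \<omega> in M. cond_probability M (F (n - 1)) {\<omega>\<in>space M. \<phi> (d n \<omega>) \<in> B} \<omega> =
        cond_probability M (filtration_limit M F) {\<omega>\<in>space M. \<phi> (e n \<omega>) \<in> B} \<omega>"
    if "n \<ge> 1" "B \<in> sets borel" for n B
    using e[unfolded decoupled_tangent_def, THEN conjunct2, THEN conjunct1, THEN spec, THEN mp, OF that(1),
        THEN bspec, OF vimage[OF that(2)]]
    by (simp only: vimage_eq)
  have sm: "strongly_measurable M (\<lambda>\<omega>. \<phi> (e n \<omega>))" if "n \<ge> 1" for n
    using e that by (intro strongly_measurable_compose[OF _ \<phi>, of M "e n"]) (simp add: decoupled_tangent_def)
  show ?thesis
    unfolding decoupled_tangent_def by (intro conjI allI ballI impI; rule sm tangent indep; assumption)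
qed

lemma decoupled_sum_bounded_linear:
  assumes "decoupled_sum M F f g" and \<phi>: "bounded_linear \<phi>"
  shows "decoupled_sum M F (\<lambda>n \<omega>. \<phi> (f n \<omega>)) (\<lambda>n \<omega>. \<phi> (g n \<omega>))"
proof -
  have inc: "increments (\<lambda>n \<omega>. \<phi> (h n \<omega>)) = (\<lambda>n \<omega>. \<phi> (increments h n \<omega>))" for h :: "nat \<Rightarrow> 'a \<Rightarrow> 'b"
    by (auto simp: increments_def fun_eq_iff linear_diff[OF bounded_linear.linear[OF \<phi>]])
  show ?thesis
    using assms(1) unfolding decoupled_sum_def inc
    by (rule decoupled_tangent_compose[OF _ linear_continuous_on[OF \<phi>]])
qed

lemma sum_increments:
  "n \<ge> 1 \<Longrightarrow> (\<Sum>k\<in>{1..n}. increments f k \<omega>) = f n \<omega>"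
  by (induction n rule: nat_induct_at_least) (auto simp: increments_def)

text \<open>Only the increments of \<open>g\<close> are measurable by definition; telescoping
  recovers \<open>g n\<close>. The real case is what is applied to the inner products of
  \<open>g n\<close> with fixed vectors.\<close>

lemma decoupled_sum_borel_measurable:
  fixes g :: "nat \<Rightarrow> 'a \<Rightarrow> real"
  assumes "decoupled_sum M F f g" "n \<ge> 1"
  shows "g n \<in> borel_measurable M"
proof -
  have "(\<lambda>\<omega>. \<Sum>k\<in>{1..n}. increments g k \<omega>) \<in> borel_measurable M"
    using assms by (intro borel_measurable_sum)
      (auto simp: decoupled_sum_def decoupled_tangent_def strongly_measurable_def)
  then show ?thesis using assms(2) by (simp only: sum_increments)
qed

section \<open>The scalar constant and its transfer to Hilbert space\<close>

context complete_filtered_prob_space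
begin

lemma subalgebra_filtration_limit: "subalgebra M (filtration_limit M F)"
proof -
  have "(\<Union>n\<in>{1..}. sets (F n)) \<subseteq> sets M"
    using subalgebra_F by (auto simp: subalgebra_def)
  then show ?thesis
    unfolding subalgebra_def filtration_limit_def
    using sets.space_closed[of M] by (simp add: sets.sigma_sets_subset subset_trans[of _ "sets M"])
qed

text \<open>The event is empty or the whole space, hence belongs to \<open>G\<close>, and
  conditioning leaves its indicator unchanged.\<close>

lemma AE_cond_probability_trivial:
  assumes "subalgebra M G"
  shows "AE \<omega> in M. cond_probability M G {\<omega>\<in>space M. P} \<omega> = of_bool P"
proof -
  interpret G: finite_measure_subalgebra M G
    using assms by unfold_locales
  let ?A = "{\<omega>\<in>space M. P}"
  have "?A \<in> sets G"
    using assms sets.top[of G] by (cases P) (simp_all add: subalgebra_def)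
  then have "indicat_real ?A \<in> borel_measurable G" by (rule borel_measurable_indicator)
  moreover have "integrable M (indicat_real ?A)"
    by (rule integrable_real_indicator) (simp_all add: emeasure_eq_measure)
  ultimately have "AE \<omega> in M. real_cond_exp M G (indicat_real ?A) \<omega> = indicator ?A \<omega>"
    by (intro G.real_cond_exp_F_meas)
  then show ?thesis
    unfolding cond_probability_def using AE_space
  proof eventually_elim
    case (elim \<omega>)
    then show ?case by (cases P) simp_all
  qed
qed

text \<open>All conditional probabilities are 0 or 1 almost surely, so the product rule becomes the
  truth table of a finite conjunction.\<close>

lemma decoupled_tangent_deterministic:
  "decoupled_tangent M F (\<lambda>n _. a n) (\<lambda>n _. a n)"
proof -
  note triv = AE_cond_probability_trivial[OF subalgebra_filtration_limit]
  have tangent: "AE \<omega> in M. cond_probability M (F m) {\<omega>\<in>space M. a n \<in> B} \<omega> =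
      cond_probability M (filtration_limit M F) {\<omega>\<in>space M. a n \<in> B} \<omega>" for m n B
    using AE_cond_probability_trivial[OF subalgebra_F[of m], of "a n \<in> B"] triv[of "a n \<in> B"]
    by eventually_elim simp
  have indep: "AE \<omega> in M. cond_probability M (filtration_limit M F) {\<omega>\<in>space M. \<forall>k\<in>{1..n}. a k \<in> B k} \<omega> =
      (\<Prod>k\<in>{1..n}. cond_probability M (filtration_limit M F) {\<omega>\<in>space M. a k \<in> B k} \<omega>)" for n B
  proof -
    have "AE \<omega> in M. \<forall>k\<in>{1..n}. cond_probability M (filtration_limit M F) {\<omega>\<in>space M. a k \<in> B k} \<omega> = of_bool (a k \<in> B k)"
      by (rule AE_finite_allI) (use triv in auto)
    with triv[of "\<forall>k\<in>{1..n}. a k \<in> B k"] show ?thesis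
      by eventually_elim (auto simp: prod.neutral)
  qed
  show ?thesis
    unfolding decoupled_tangent_def
    by (intro conjI allI ballI impI; rule strongly_measurable_const tangent indep)
qed

text \<open>
  Excludes the junk value \<open>0 * \<infinity> = 0\<close> when the norm of \<open>g\<^sub>n\<close> is infinite.
\<close>

lemma one_le_real_decoupling_constant: "1 \<le> real_decoupling_constant TYPE('a)"
proof -
  \<comment> \<open>The witness is the constant process 1, decoupled by itself, at exponent 1: both
    norms equal 1, so no admissible constant is below 1.\<close>
  have norm_1: "Lp_norm M 1 (\<lambda>_. 1::real) = 1"
    by (simp add: Lp_norm_def emeasure_space_1)
  have inc: "increments (\<lambda>_ _. 1) = (\<lambda>n (_::'a). if n \<le> 1 then 1 else 0::real)"
    by (auto simp: increments_def fun_eq_iff)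
  have "decoupled_sum M F (\<lambda>_ _. 1::real) (\<lambda>_ _. 1)"
    unfolding decoupled_sum_def inc by (rule decoupled_tangent_deterministic)
  moreover have "adapted_seq F (\<lambda>_ _. 1::real)" "\<forall>n\<ge>1. in_Lp M 1 (\<lambda>_. 1::real)"
    by (simp_all add: adapted_seq_def in_Lp_def strongly_measurable_const norm_1)
  ultimately have "1 \<le> decoupling_constant TYPE('a) TYPE(real) 1"
    unfolding decoupling_constant_def
    using complete_filtered_prob_space_axioms norm_1
    by (intro Inf_greatest) (force dest!: spec[of _ M] spec[of _ F] spec[of _ "\<lambda>_ _. 1::real"])
  then show ?thesis
    unfolding real_decoupling_constant_def by (intro SUP_upper2[of 1]) auto
qed

text \<open>The strict bound supplies an admissible constant below \<open>C\<close>, so that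
  attainment of the infimum is never at issue.\<close>

lemma real_Lp_norm_le:
  fixes f g :: "nat \<Rightarrow> 'a \<Rightarrow> real"
  assumes C: "decoupling_constant TYPE('a) TYPE(real) p < C"
    and "adapted_seq F f" "\<forall>n\<ge>1. in_Lp M p (f n)" "decoupled_sum M F f g" "n \<ge> 1"
  shows "Lp_norm M p (f n) \<le> C * Lp_norm M p (g n)"
proof -
  from C obtain C' where C': "C' < C" "Lp_norm M p (f n) \<le> C' * Lp_norm M p (g n)"
    unfolding decoupling_constant_def Inf_less_iff
    using complete_filtered_prob_space_axioms assms(2-) by blast
  have "C' * Lp_norm M p (g n) \<le> C * Lp_norm M p (g n)"
    using C' by (intro mult_right_mono) auto
  with C'(2) show ?thesis by (rule order_trans)
qed

text \<open>The scalar inequality, raised to the power \<open>r\<close>, has the factor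
  \<open>C powr r\<close> for every direction \<open>y\<close>, as the Gaussian transfer requires.
  The scalar processes live on the same \<open>M\<close> and \<open>F\<close>, so the constant for
  the sample type \<open>'a\<close> suffices.\<close>

lemma hilbert_Lp_norm_le:
  fixes f g :: "nat \<Rightarrow> 'a \<Rightarrow> 'x::real_inner"
  assumes r: "r \<ge> 1" and C: "decoupling_constant TYPE('a) TYPE(real) (ennreal r) < ennreal C"
    and f: "adapted_seq F f" "\<forall>n\<ge>1. in_Lp M (ennreal r) (f n)"
    and g: "decoupled_sum M F f g" and n: "n \<ge> 1"
  shows "Lp_norm M (ennreal r) (f n) \<le> ennreal C * Lp_norm M (ennreal r) (g n)"
proof -
  have r0: "r > 0" using r by simp
  \<comment> \<open>Positivity of \<open>C\<close> makes the right-hand side infinite whenever the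
    norm or integral of \<open>g\<close> is infinite.\<close>
  have C0: "C > 0" using C by (metis ennreal_less_zero_iff not_gr_zero not_less_zero)
  let ?I = "\<lambda>u. \<integral>\<^sup>+\<omega>. ennreal (norm (u \<omega>) powr r) \<partial>M"
  have dec: "decoupled_sum M F (\<lambda>n \<omega>. f n \<omega> \<bullet> y) (\<lambda>n \<omega>. g n \<omega> \<bullet> y)" for y
    by (rule decoupled_sum_bounded_linear[OF g bounded_linear_inner_left])
  have scalar: "(\<integral>\<^sup>+\<omega>. ennreal (\<bar>f n \<omega> \<bullet> y\<bar> powr r) \<partial>M) \<le>
      ennreal (C powr r) * (\<integral>\<^sup>+\<omega>. ennreal (\<bar>g n \<omega> \<bullet> y\<bar> powr r) \<partial>M)" for y
  proof (cases "\<integral>\<^sup>+\<omega>. ennreal (\<bar>g n \<omega> \<bullet> y\<bar> powr r) \<partial>M")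
    case (real j)
    have sm: "strongly_measurable N (\<lambda>\<omega>. h \<omega> \<bullet> y)" if "strongly_measurable N h" for N :: "'a measure" and h
      using that by (rule strongly_measurable_compose[where \<phi> = "\<lambda>x. x \<bullet> y"]) (intro continuous_intros)
    \<comment> \<open>The scalar constant applies only to processes in \<open>L\<^sup>r\<close> at
      every index; Cauchy-Schwarz bounds each norm by \<open>norm y * l\<close>.\<close>
    have "in_Lp M (ennreal r) (\<lambda>\<omega>. f m \<omega> \<bullet> y)" if "m \<ge> 1" for m
    proof -
      have fm: "strongly_measurable M (f m)" "Lp_norm M (ennreal r) (f m) < \<infinity>"
        using f(2) that by (auto simp: in_Lp_def)
      then obtain l where l: "l \<ge> 0" "Lp_norm M (ennreal r) (f m) = ennreal l"
        by (cases "Lp_norm M (ennreal r) (f m)") auto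
      have [measurable]: "f m \<in> borel_measurable M" using fm by (simp add: strongly_measurable_def)
      have "?I (\<lambda>\<omega>. f m \<omega> \<bullet> y) \<le> (\<integral>\<^sup>+\<omega>. ennreal (norm y powr r) * ennreal (norm (f m \<omega>) powr r) \<partial>M)"
        using r Cauchy_Schwarz_ineq2[of _ y]
        by (intro nn_integral_mono)
          (auto simp: ennreal_mult'[symmetric] powr_mult[symmetric] mult.commute[of "norm y"] intro!: ennreal_leI powr_mono2)
      also have "\<dots> = ennreal (norm y powr r) * ?I (f m)" by (rule nn_integral_cmult) measurable
      also have "\<dots> \<le> ennreal (norm y powr r) * ennreal (l powr r)"
        using l r0 Lp_norm_le_iff[of r l M "f m"] by (intro mult_left_mono) auto
      also have "\<dots> = ennreal ((norm y * l) powr r)"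
        using l by (simp add: ennreal_mult'[symmetric] powr_mult)
      finally have "Lp_norm M (ennreal r) (\<lambda>\<omega>. f m \<omega> \<bullet> y) \<le> ennreal (norm y * l)"
        using l r0 by (subst Lp_norm_le_iff) auto
      then show ?thesis using sm[OF fm(1)] by (auto simp: in_Lp_def intro: le_less_trans)
    qed
    moreover have "adapted_seq F (\<lambda>n \<omega>. f n \<omega> \<bullet> y)"
      using f(1) sm by (auto simp: adapted_seq_def)
    ultimately have "Lp_norm M (ennreal r) (\<lambda>\<omega>. f n \<omega> \<bullet> y) \<le> ennreal C * Lp_norm M (ennreal r) (\<lambda>\<omega>. g n \<omega> \<bullet> y)"
      using real_Lp_norm_le[OF C _ _ dec n] by blast
    also have "\<dots> \<le> ennreal C * ennreal (j powr (1 / r))"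
      using real r0 by (intro mult_left_mono) (auto simp: Lp_norm_le_iff powr_powr)
    also have "\<dots> = ennreal (C * j powr (1 / r))" using C0 by (simp add: ennreal_mult')
    finally have "?I (\<lambda>\<omega>. f n \<omega> \<bullet> y) \<le> ennreal ((C * j powr (1 / r)) powr r)"
      using C0 r0 by (subst (asm) Lp_norm_le_iff) auto
    then show ?thesis
      using real C0 r0 by (simp add: powr_mult powr_powr ennreal_mult')
  next
    case top
    then show ?thesis using C0 by (simp add: ennreal_mult_top)
  qed
  have I_le: "?I (f n) \<le> ennreal (C powr r) * ?I (g n)"
  proof (rule nn_integral_norm_powr_le_of_inner[OF r0 _ _ _ scalar])
    show "sigma_finite_measure M" by unfold_locales
    show "strongly_measurable M (f n)" using f(2) n by (simp add: in_Lp_def)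
    show "(\<lambda>\<omega>. g n \<omega> \<bullet> y) \<in> borel_measurable M" for y
      using decoupled_sum_borel_measurable[OF dec n] .
  qed
  show ?thesis
  proof (cases "Lp_norm M (ennreal r) (g n)")
    case (real l)
    have "?I (f n) \<le> ennreal (C powr r) * ennreal (l powr r)"
      using I_le real r0 Lp_norm_le_iff[of r l M "g n"]
      by (intro order_trans[OF I_le] mult_left_mono) auto
    also have "\<dots> = ennreal ((C * l) powr r)"
      using C0 real by (simp add: powr_mult ennreal_mult')
    finally show ?thesis
      using C0 real r0 by (simp add: Lp_norm_le_iff ennreal_mult'[symmetric])
  next
    case top
    then show ?thesis using C0 by (simp add: ennreal_mult_top)
  qed
qed

text \<open>On a probability space the \<open>L\<^sup>r\<close> norm of \<open>g n\<close> is at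
  most its essential supremum. With one \<open>C\<close> for all finite \<open>r\<close>, the
  resulting bound on \<open>f n\<close> is uniform in \<open>r\<close> and survives the
  limit.\<close>

lemma hilbert_Lp_norm_infinity_le:
  fixes f g :: "nat \<Rightarrow> 'a \<Rightarrow> 'x::real_inner"
  assumes C: "\<And>r. r \<ge> 1 \<Longrightarrow> decoupling_constant TYPE('a) TYPE(real) (ennreal r) < ennreal C" and C0: "C > 0"
    and f: "adapted_seq F f" "\<forall>n\<ge>1. in_Lp M \<infinity> (f n)"
    and g: "decoupled_sum M F f g" and n: "n \<ge> 1"
  shows "Lp_norm M \<infinity> (f n) \<le> ennreal C * Lp_norm M \<infinity> (g n)"
proof (cases "Lp_norm M \<infinity> (g n)")
  case (real l)
  have "Lp_norm M \<infinity> (f n) \<le> ennreal (C * l)"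
  proof (rule Lp_norm_infinity_le)
    show "f n \<in> borel_measurable M" using f(2) n by (auto simp: in_Lp_def strongly_measurable_def)
    show "C * l \<ge> 0" using C0 real by simp
    fix r :: real assume r: "r \<ge> 1"
    have "in_Lp M (ennreal r) (f m)" if "m \<ge> 1" for m
      using f(2) that r Lp_norm_le_Lp_norm_infinity[of r "f m"] by (auto simp: in_Lp_def intro: le_less_trans)
    then have "Lp_norm M (ennreal r) (f n) \<le> ennreal C * Lp_norm M (ennreal r) (g n)"
      using hilbert_Lp_norm_le[OF r C[OF r] f(1) _ g n] by blast
    also have "\<dots> \<le> ennreal C * ennreal l"
      using real r Lp_norm_le_Lp_norm_infinity[of r "g n"] by (intro mult_left_mono) auto
    finally show "Lp_norm M (ennreal r) (f n) \<le> ennreal (C * l)"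
      using C0 by (simp add: ennreal_mult')
  qed
  then show ?thesis using real C0 by (simp add: ennreal_mult')
next
  case top
  then show ?thesis using C0 by (simp add: ennreal_mult_top)
qed

end

theorem corollary4p9:
  fixes M :: "'a measure" and F :: "nat \<Rightarrow> 'a measure"
    and f g :: "nat \<Rightarrow> 'a \<Rightarrow> 'x::{real_inner, complete_space}"
    and p :: ennreal
  assumes hitczenko: "real_decoupling_constant TYPE('a) < \<infinity>"
    and p: "p \<in> {1..\<infinity>}"
    and space: "complete_filtered_prob_space M F"
    and adapted: "adapted_seq F f"
    and Lp: "\<forall>n\<ge>1. in_Lp M p (f n)"
    and g: "decoupled_sum M F f g"
  shows "\<forall>n\<ge>1. Lp_norm M p (f n) \<le> real_decoupling_constant TYPE('a) * Lp_norm M p (g n)"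
proof (intro allI impI)
  fix n :: nat assume n: "n \<ge> 1"
  interpret complete_filtered_prob_space M F by (rule space)
  obtain D where D: "D \<ge> 0" "real_decoupling_constant TYPE('a) = ennreal D"
    using hitczenko by (cases "real_decoupling_constant TYPE('a)") auto
  have D1: "D \<ge> 1" using one_le_real_decoupling_constant D by simp
  \<comment> \<open>A constant strictly above \<open>D\<close> exceeds every scalar constant
    strictly, as the two transfer lemmas demand; the excess is removed at the end.\<close>
  have le: "Lp_norm M p (f n) \<le> ennreal C * Lp_norm M p (g n)" if "C > D" for C
  proof -
    have const: "decoupling_constant TYPE('a) TYPE(real) (ennreal r) < ennreal C" if "r \<ge> 1" for r
    proof -
      have "decoupling_constant TYPE('a) TYPE(real) (ennreal r) \<le> ennreal D"
        unfolding D(2)[symmetric] real_decoupling_constant_def using that by (intro SUP_upper) auto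
      also have "\<dots> < ennreal C" using \<open>C > D\<close> D by (simp add: ennreal_lessI)
      finally show ?thesis .
    qed
    show ?thesis
    proof (cases p)
      case (real r)
      then have r: "r \<ge> 1" using p by simp
      show ?thesis
        using hilbert_Lp_norm_le[OF r const[OF r] adapted _ g n] Lp real by simp
    next
      case top
      then show ?thesis
        using hilbert_Lp_norm_infinity_le[OF const _ adapted _ g n] Lp that D by simp
    qed
  qed
  show "Lp_norm M p (f n) \<le> real_decoupling_constant TYPE('a) * Lp_norm M p (g n)"
  proof (cases "Lp_norm M p (g n)")
    case (real l)
    have "Lp_norm M p (f n) \<le> ennreal (D * l)"
    proof (rule ennreal_le_epsilon)
      fix e :: real assume e: "e > 0"
      \<comment> \<open>The excess \<open>e / (l + 1)\<close> costs
        \<open>e * (l / (l + 1))\<close>, which is at most \<open>e\<close>, and the denominator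
        stays positive when \<open>l = 0\<close>.\<close>
      have "Lp_norm M p (f n) \<le> ennreal (D + e / (l + 1)) * ennreal l"
        using le[of "D + e / (l + 1)"] real e by simp
      also have "\<dots> = ennreal (D * l + e * (l / (l + 1)))"
        using D e real by (simp add: ennreal_mult'[symmetric] distrib_right)
      also have "\<dots> \<le> ennreal (D * l + e)"
        using e real by (intro ennreal_leI add_left_mono mult_left_le) (auto simp: divide_le_eq_1)
      finally show "Lp_norm M p (f n) \<le> ennreal (D * l) + ennreal e"
        using D e real by simp
    qed
    then show ?thesis using D real by (simp add: ennreal_mult')
  next
    case top
    then show ?thesis using D D1 by (simp add: ennreal_mult_top)
  qed
qed

end
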